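(* Let $X$ be a compact Hausdorff space and let $A$ be a commutative semisimple complex Banach algebra with unit element $\mathbf{1}$. For every $f\in C(X,A)$, the spectrum $\vec{\mathrm{sp}}(f)$ is a compact subset of $C(X)$.
   Context: $C(X,A)$ is the algebra of all continuous functions $X\to A$, and $C(X)=C(X,\mathbb{C})$ carries the uniform norm. The vector-valued spectrum $\vec{\mathrm{sp}}(f)$ of a function $f:X\to A$ is the set of all functions $\lambda:X\to\mathbb{C}$ such that, for every finite subset $F\subset X$, $\mathbf{1}\notin\sum_{x\in F}A\,(\lambda(x)\mathbf{1}-f(x))$. *)

theory Defs
  imports "HOL-Analysis.Analysis" "HOL-Algebra.Algebraic_Closure_Type"
begin

(* Complex scalars refine the real ones. Right compatibility of scaleC with the product
   follows from commutativity. The unit is only required to be nonzero, not of norm 1. *)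

class comm_complex_banach_algebra_1 = real_normed_algebra + comm_ring_1 + banach +
  fixes scaleC :: "complex \<Rightarrow> 'a \<Rightarrow> 'a"
  assumes scaleC_add_right: "scaleC c (x + y) = scaleC c x + scaleC c y"
    and scaleC_add_left: "scaleC (c + d) x = scaleC c x + scaleC d x"
    and scaleC_scaleC: "scaleC c (scaleC d x) = scaleC (c * d) x"
    and scaleC_one: "scaleC 1 x = x"
    and scaleC_of_real: "scaleC (complex_of_real r) x = scaleR r x"
    and mult_scaleC_left: "scaleC c x * y = scaleC c (x * y)"
    and norm_scaleC: "norm (scaleC c x) = cmod c * norm x"

instantiation complex :: comm_complex_banach_algebra_1
begin

definition scaleC_complex :: "complex \<Rightarrow> complex \<Rightarrow> complex"
  where "scaleC_complex c x = c * x"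

instance
  by standard (simp_all add: scaleC_complex_def algebra_simps norm_mult scaleR_conv_of_real)

end

definition jacobson_radical :: "'a::comm_ring_1 set"
  where "jacobson_radical = \<Inter>{I. maximalideal I (ring_of_type_algebra :: 'a ring)}"

(* The compact space is an abstract topology, so functions on it are represented by their
   extensional representatives, as in cfunspace. *)

definition vector_spectrum ::
  "'x topology \<Rightarrow> ('x \<Rightarrow> 'a::comm_complex_banach_algebra_1) \<Rightarrow> ('x \<Rightarrow> complex) set"
  where "vector_spectrum T f =
    {l \<in> topspace T \<rightarrow>\<^sub>E UNIV.
       \<forall>F. finite F \<and> F \<subseteq> topspace T \<longrightarrow>
         1 \<notin> {\<Sum>x\<in>F. a x * (scaleC (l x) 1 - f x) | a. True}}"

end

theory Submission
  imports Defs
begin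

text \<open>
  The spectrum is compact by the Arzela--Ascoli argument, carried out directly on the defining
  condition.

  Everything rests on the fact that \<open>c\<cdot>1 - b\<close> is a unit as soon as \<open>norm b < cmod c\<close>. It has three
  consequences for a member \<open>l\<close> of the spectrum of \<open>f\<close>, that is, a function for which the elements
  \<open>l x \<cdot> 1 - f x\<close> generate a proper ideal.

  \<^item> This ideal contains no unit, in particular not \<open>l x \<cdot> 1 - f x\<close>, so \<open>cmod (l x) \<le> norm (f x)\<close>.
  \<^item> It also does not contain the unit that \<open>(l x - l y) \<cdot> 1 - (f x - f y)\<close> would be for
    \<open>cmod (l x - l y) > norm (f x - f y)\<close>. So \<open>f\<close> itself is a common modulus of continuity of
    all the functions in its spectrum.
  \<^item> All elements of a proper ideal have distance at least 1 from the unit element. Membership in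
    the spectrum is therefore a conjunction of non-strict norm inequalities, each of them involving
    only finitely many values of \<open>l\<close>, and so the spectrum is closed under pointwise limits.

  By the first and the third item and by Tychonoff's theorem the spectrum is compact for pointwise
  convergence. By the second item the pointwise and the uniform topology agree on it, because a
  finite \<open>\<epsilon>\<close>-net of the compact image of \<open>f\<close> controls all the values at once.
\<close>

section \<open>Invertibility near the unit element\<close>

text \<open>
  An inverse of \<open>1 - x\<close> is a fixed point of the contraction \<open>y \<mapsto> 1 + y x\<close>. This form of the
  Neumann series avoids the powers of \<open>x\<close>, whose norm bound fails at the zeroth power when the
  norm of the unit element exceeds 1.
\<close>

lemma one_minus_left_invertible:
  fixes x :: "'a::{real_normed_algebra, comm_ring_1, banach}"
  assumes "norm x < 1"
  obtains y where "y * (1 - x) = 1"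
proof -
  have "dist (1 + y * x) (1 + z * x) \<le> norm x * dist y z" for y z
    using norm_mult_ineq[of "y - z" x] by (simp add: dist_norm left_diff_distrib mult.commute[of "norm x"])
  then obtain y where "1 + y * x = y"
    using banach_fix_type[of "norm x" "\<lambda>y. 1 + y * x"] assms by auto
  then have "y * (1 - x) = 1"
    by (simp add: right_diff_distrib algebra_simps)
  then show thesis ..
qed

lemma scaleC_mult_one:
  "scaleC c 1 * x = scaleC c (x::'a::comm_complex_banach_algebra_1)"
  by (simp add: mult_scaleC_left)

lemma scaleC_diff_left:
  "scaleC (c - d) (x::'a::comm_complex_banach_algebra_1) = scaleC c x - scaleC d x"
  using scaleC_add_left[of "c - d" d x] by (simp add: algebra_simps)

lemma scaleC_one_minus_left_invertible:
  fixes b :: "'a::comm_complex_banach_algebra_1"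
  assumes "norm b < cmod c"
  obtains u where "u * (scaleC c 1 - b) = 1"
proof -
  have c: "c \<noteq> 0"
    using assms by auto
  have "norm (scaleC (inverse c) b) < 1"
    using assms c by (simp add: norm_scaleC norm_divide divide_simps)
  then obtain y where y: "y * (1 - scaleC (inverse c) b) = 1"
    by (rule one_minus_left_invertible)
  have "scaleC (inverse c) 1 * (scaleC c 1 - b) = 1 - scaleC (inverse c) b"
    using c by (simp add: right_diff_distrib scaleC_mult_one scaleC_scaleC scaleC_one)
  then have "(y * scaleC (inverse c) 1) * (scaleC c 1 - b) = 1"
    using y by (simp only: mult.assoc)
  then show thesis ..
qed

lemma continuous_scaleC_left:
  "continuous_on UNIV (\<lambda>c. scaleC c (x::'a::comm_complex_banach_algebra_1))"
proof (rule lipschitz_on_continuous_on)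
  show "(norm x)-lipschitz_on UNIV (\<lambda>c. scaleC c x)"
    by (rule lipschitz_onI)
      (simp_all add: dist_norm norm_scaleC mult.commute flip: scaleC_diff_left)
qed

section \<open>The vector-valued spectrum\<close>

lemma vector_spectrumD:
  assumes "l \<in> vector_spectrum T f" "finite F" "F \<subseteq> topspace T"
  shows "(\<Sum>x\<in>F. a x * (scaleC (l x) 1 - f x)) \<noteq> 1"
proof
  assume "(\<Sum>x\<in>F. a x * (scaleC (l x) 1 - f x)) = 1"
  then have "1 \<in> {\<Sum>x\<in>F. a x * (scaleC (l x) 1 - f x) | a. True}"
    by (metis (mono_tags, lifting) mem_Collect_eq)
  with assms show False
    unfolding vector_spectrum_def by blast
qed

text \<open>
  The sums appearing here form an ideal. If one of them had distance less than 1 from the unit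
  element, it would be a unit, and some multiple of it would be equal to the unit element.
\<close>

lemma vector_spectrum_iff_norm:
  "l \<in> vector_spectrum T f \<longleftrightarrow>
     l \<in> topspace T \<rightarrow>\<^sub>E UNIV \<and>
     (\<forall>F a. finite F \<longrightarrow> F \<subseteq> topspace T \<longrightarrow>
        1 \<le> norm (1 - (\<Sum>x\<in>F. a x * (scaleC (l x) 1 - f x))))"
  (is "?L \<longleftrightarrow> ?E \<and> ?R")
proof (intro iffI conjI)
  assume L: ?L
  then show ?E
    by (simp add: vector_spectrum_def)
  show ?R
  proof (intro allI impI)
    fix F a
    assume F: "finite F" "F \<subseteq> topspace T"
    let ?s = "\<Sum>x\<in>F. a x * (scaleC (l x) 1 - f x)"
    show "1 \<le> norm (1 - ?s)"
    proof (rule ccontr)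
      assume "\<not> ?thesis"
      then obtain y where "y * (1 - (1 - ?s)) = 1"
        using one_minus_left_invertible[of "1 - ?s"] by auto
      then have "(\<Sum>x\<in>F. (y * a x) * (scaleC (l x) 1 - f x)) = 1"
        by (simp add: sum_distrib_left mult.assoc)
      with vector_spectrumD[OF L F, of "\<lambda>x. y * a x"] show False ..
    qed
  qed
next
  assume R: "?E \<and> ?R"
  have "1 \<noteq> (\<Sum>x\<in>F. a x * (scaleC (l x) 1 - f x))" if F: "finite F \<and> F \<subseteq> topspace T" for F a
  proof
    assume eq: "1 = (\<Sum>x\<in>F. a x * (scaleC (l x) 1 - f x))"
    have "1 \<le> norm (1 - (\<Sum>x\<in>F. a x * (scaleC (l x) 1 - f x)))"
      using R F by blast
    then show False
      unfolding eq[symmetric] by simp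
  qed
  with R show ?L
    unfolding vector_spectrum_def by blast
qed

lemma vector_spectrum_norm_le:
  assumes l: "l \<in> vector_spectrum T f" and x: "x \<in> topspace T"
  shows "cmod (l x) \<le> norm (f x)"
proof (rule ccontr)
  assume "\<not> ?thesis"
  then obtain u where "u * (scaleC (l x) 1 - f x) = 1"
    using scaleC_one_minus_left_invertible[of "f x" "l x"] by auto
  with vector_spectrumD[OF l, of "{x}" "\<lambda>_. u"] x show False
    by simp
qed

lemma vector_spectrum_dist_le:
  assumes l: "l \<in> vector_spectrum T f" and x: "x \<in> topspace T" and y: "y \<in> topspace T"
  shows "dist (l x) (l y) \<le> dist (f x) (f y)"
proof (rule ccontr)
  assume neg: "\<not> ?thesis"
  then have xy: "x \<noteq> y"
    by auto
  obtain u where u: "u * (scaleC (l x - l y) 1 - (f x - f y)) = 1"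
    using neg scaleC_one_minus_left_invertible[of "f x - f y" "l x - l y"] by (auto simp: dist_norm)
  have "(\<Sum>z\<in>{x, y}. (if z = x then u else - u) * (scaleC (l z) 1 - f z)) = 1"
    using u xy by (simp add: scaleC_diff_left algebra_simps)
  with vector_spectrumD[OF l, of "{x, y}" "\<lambda>z. if z = x then u else - u"] x y show False
    by simp
qed

section \<open>Compactness for pointwise and for uniform convergence\<close>

lemma vector_spectrum_closedin_pointwise:
  "closedin (product_topology (\<lambda>_. euclidean) (topspace T)) (vector_spectrum T f)"
  (is "closedin ?P _")
proof -
  let ?s = "\<lambda>F a l. 1 - (\<Sum>x\<in>F. a x * (scaleC (l x) 1 - f x))"
  have closed: "closedin ?P {l \<in> topspace ?P. norm (?s F a l) \<in> {1..}}"
    if F: "finite F" "F \<subseteq> topspace T" for F a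
  proof (rule closedin_continuous_map_preimage)
    have "continuous_map ?P euclidean (\<lambda>l. a x * (scaleC (l x) 1 - f x))" if "x \<in> F" for x
    proof -
      have "continuous_map ?P euclidean (\<lambda>l. l x)"
        using that F by (auto intro: continuous_map_product_projection)
      moreover have "continuous_on UNIV (\<lambda>c. a x * (scaleC c 1 - f x))"
        by (intro continuous_intros continuous_scaleC_left)
      ultimately have "continuous_map ?P euclidean ((\<lambda>c. a x * (scaleC c 1 - f x)) \<circ> (\<lambda>l. l x))"
        by (intro continuous_map_compose[where X' = euclidean]) auto
      then show ?thesis
        by (simp only: o_def)
    qed
    then show "continuous_map ?P euclidean (\<lambda>l. norm (?s F a l))"
      using F by (intro continuous_intros) auto
  qed auto
  let ?Fin = "{F. finite F \<and> F \<subseteq> topspace T}"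
  have *: "l \<in> vector_spectrum T f \<longleftrightarrow>
      l \<in> topspace ?P \<and> (\<forall>F\<in>?Fin. \<forall>a. norm (?s F a l) \<in> {1..})" for l
    unfolding vector_spectrum_iff_norm topspace_product_topology topspace_euclidean atLeast_iff by blast
  have "vector_spectrum T f = (\<Inter>F\<in>?Fin. \<Inter>a. {l \<in> topspace ?P. norm (?s F a l) \<in> {1..}})"
    (is "_ = ?I")
  proof (intro subset_antisym subsetI)
    show "l \<in> ?I" if "l \<in> vector_spectrum T f" for l
      using that unfolding * by (intro INT_I CollectI) blast
    \<comment> \<open>The empty set keeps the family nonempty, so that its members are functions on \<open>T\<close>.\<close>
    have "{} \<in> ?Fin"
      by simp
    then show "l \<in> vector_spectrum T f" if "l \<in> ?I" for l
      using that unfolding * INT_iff mem_Collect_eq[of l] by blast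
  qed
  also have "closedin ?P ?I"
  proof (intro closedin_INT)
    show "closedin ?P {l \<in> topspace ?P. norm (?s F a l) \<in> {1..}}" if "F \<in> ?Fin" for F a
      using closed[of F a] that by blast
  qed auto
  finally show ?thesis .
qed

lemma vector_spectrum_compactin_pointwise:
  "compactin (product_topology (\<lambda>_. euclidean) (topspace T)) (vector_spectrum T f)"
proof (rule closed_compactin)
  show "compactin (product_topology (\<lambda>_. euclidean) (topspace T))
      (\<Pi>\<^sub>E x\<in>topspace T. cball (0::complex) (norm (f x)))"
    by (simp add: compactin_PiE)
  show "vector_spectrum T f \<subseteq> (\<Pi>\<^sub>E x\<in>topspace T. cball (0::complex) (norm (f x)))"
  proof
    fix l
    assume l: "l \<in> vector_spectrum T f"
    then have "l \<in> extensional (topspace T)"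
      by (simp add: vector_spectrum_iff_norm PiE_def)
    then show "l \<in> (\<Pi>\<^sub>E x\<in>topspace T. cball (0::complex) (norm (f x)))"
      using vector_spectrum_norm_le[OF l] by (simp add: PiE_def)
  qed
qed (rule vector_spectrum_closedin_pointwise)

text \<open>
  A form of the Arzela--Ascoli theorem in which equicontinuity is expressed by one continuous
  function \<open>f\<close> that dominates all the oscillations. Because the domain is compact, the identity map
  from the pointwise to the uniform topology is then continuous on \<open>S\<close>, and it carries the compact
  set \<open>S\<close> to a compact set.
\<close>

lemma compactin_cfunspace_if_dominated:
  fixes f :: "'x \<Rightarrow> 'b::metric_space" and S :: "('x \<Rightarrow> 'c::metric_space) set"
  assumes T: "compact_space T" and f: "continuous_map T euclidean f"
    and S: "compactin (product_topology (\<lambda>_. euclidean) (topspace T)) S"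
    and dom: "\<And>l x y. \<lbrakk>l \<in> S; x \<in> topspace T; y \<in> topspace T\<rbrakk> \<Longrightarrow> dist (l x) (l y) \<le> dist (f x) (f y)"
  shows "compactin (mtopology_of (cfunspace T euclidean_metric)) S"
proof -
  let ?P = "product_topology (\<lambda>_. euclidean :: 'c topology) (topspace T)"
  let ?C = "cfunspace T (euclidean_metric :: 'c metric)"
  interpret C: Metric_space "mspace ?C" "mdist ?C"
    by (rule Metric_space_mspace_mdist)
  have nbhd: "openin T {y \<in> topspace T. f y \<in> ball z e}" for z e
    using f by (rule openin_continuous_map_preimage) simp
  have S_ext: "S \<subseteq> topspace ?P"
    using S by (rule compactin_subset_topspace)
  have S_cont: "continuous_map T euclidean l" if l: "l \<in> S" for l
  proof -
    have "\<exists>U. openin T U \<and> x \<in> U \<and> (\<forall>y\<in>U. l y \<in> ball (l x) e)"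
      if x: "x \<in> topspace T" and e: "e > 0" for x e
    proof (intro exI conjI ballI)
      show "openin T {y \<in> topspace T. f y \<in> ball (f x) e}"
        by (rule nbhd)
      show "x \<in> {y \<in> topspace T. f y \<in> ball (f x) e}"
        using x e by simp
      show "l y \<in> ball (l x) e" if "y \<in> {y \<in> topspace T. f y \<in> ball (f x) e}" for y
        using dom[OF l x, of y] that by simp
    qed
    then show ?thesis
      using Metric_space.continuous_map_to_metric[OF Met_TC.Metric_space_axioms, of T l]
      by (simp add: Met_TC.mball_def)
  qed
  have S_mspace: "S \<subseteq> mspace ?C"
  proof
    fix l
    assume l: "l \<in> S"
    have "l \<in> extensional (topspace T)"
      using subsetD[OF S_ext l] by (simp add: PiE_def)
    then show "l \<in> mspace ?C"
      unfolding compactin_mspace_cfunspace[OF T[unfolded compact_space_def]]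
      using S_cont[OF l] by simp
  qed
  have close: "\<exists>U. openin (subtopology ?P S) U \<and> l \<in> U \<and> (\<forall>k\<in>U. k \<in> C.mball l e)"
    if l: "l \<in> S" and e: "e > 0" for l e
  proof -
    have "compact (f ` topspace T)"
      using image_compactin[OF _ f] T by (simp add: compact_space_def)
    moreover have "f ` topspace T \<subseteq> (\<Union>y\<in>topspace T. ball (f y) (e/4))"
      using e by force
    ultimately obtain F where F: "F \<subseteq> topspace T" "finite F"
        "f ` topspace T \<subseteq> (\<Union>y\<in>F. ball (f y) (e/4))"
      using compactE_image[of "f ` topspace T" "topspace T" "\<lambda>y. ball (f y) (e/4)"] by auto
    define U where "U = {k \<in> topspace (subtopology ?P S). \<forall>y\<in>F. k y \<in> ball (l y) (e/4)}"
    have "openin (subtopology ?P S) {k \<in> topspace (subtopology ?P S). k y \<in> ball (l y) (e/4)}"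
      if "y \<in> F" for y
      using that F
      by (intro openin_continuous_map_preimage[where Y = euclidean]
          continuous_map_from_subtopology continuous_map_product_projection) auto
    then have "openin (subtopology ?P S) ((\<Inter>y\<in>F. {k \<in> topspace (subtopology ?P S). k y \<in> ball (l y) (e/4)})
        \<inter> topspace (subtopology ?P S))"
      using F(2) by (intro openin_INT)
    also have "\<dots> = U"
      by (auto simp: U_def)
    finally have "openin (subtopology ?P S) U" .
    moreover have "l \<in> U"
      using l S_ext e by (auto simp: U_def)
    moreover have "k \<in> C.mball l e" if k: "k \<in> U" for k
    proof -
      have kS: "k \<in> S"
        using k by (auto simp: U_def)
      \<comment> \<open>A bound strictly below \<open>e\<close>, since strictness is lost in the supremum over \<open>x\<close>.\<close>
      have "dist (l x) (k x) \<le> 3 * e / 4" if x: "x \<in> topspace T" for x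
      proof -
        obtain y where y: "y \<in> F" "dist (f y) (f x) < e/4"
          using F(3) x by auto
        then have "dist (l y) (l x) < e/4" "dist (k y) (k x) < e/4" "dist (l y) (k y) < e/4"
          using dom[OF l, of y x] dom[OF kS, of y x] F(1) x k by (auto simp: U_def)
        then show ?thesis
          using dist_triangle[of "l x" "k x" "l y"] dist_triangle[of "l y" "k x" "k y"]
          by (simp add: dist_commute)
      qed
      then have "mdist ?C l k \<le> 3 * e / 4"
        using e by (intro mdist_cfunspace_le) auto
      then show ?thesis
        using e subsetD[OF S_mspace l] subsetD[OF S_mspace kS] unfolding C.in_mball by linarith
    qed
    ultimately show ?thesis
      by blast
  qed
  have "continuous_map (subtopology ?P S) C.mtopology id"
    unfolding C.continuous_map_to_metric using close by auto
  then have "compactin C.mtopology (id ` S)"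
    using S by (intro image_compactin[of "subtopology ?P S"]) (auto simp: compactin_subtopology)
  then show ?thesis
    by (simp add: mtopology_of_def)
qed

theorem theorem3p3:
  fixes T :: "'x topology"
    and f :: "'x \<Rightarrow> 'a::comm_complex_banach_algebra_1"
  assumes "compact_space T" and "Hausdorff_space T"
    and semisimple: "(jacobson_radical :: 'a set) = {0}"
    and "continuous_map T euclidean f"
  shows "compactin (mtopology_of (cfunspace T euclidean_metric)) (vector_spectrum T f)"
proof (rule compactin_cfunspace_if_dominated[OF assms(1,4) vector_spectrum_compactin_pointwise])
  fix l x y
  assume "l \<in> vector_spectrum T f" "x \<in> topspace T" "y \<in> topspace T"
  then show "dist (l x) (l y) \<le> dist (f x) (f y)"
    by (rule vector_spectrum_dist_le)
qed

end
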